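(* Let $(t_n)_{n\in\mathbb N_0}$ be a sequence of natural numbers with $t_0>0$ and $t_n>\sum_{k=0}^{n-1}t_k$ for every $n\in\mathbb N$, and let $B(t_n)$ be the associated generalized Bratteli diagram with left-to-right order and Vershik map $\varphi_{B(t_n)}$. Put $L_0=2t_0$ and $L_n=2\big(t_n-\sum_{k=0}^{n-1}t_k\big)$, $n\in\mathbb N$. Then: \begin{enumerate} \item If for every finite collection $s_1,\dots,s_n\in\mathbb N_0$ the sum $L_{s_1}+\cdots+L_{s_n}\neq0$, then there is no probability tail invariant measure on $X_{B(t_n)}$. \item There is no dense $\varphi_{B(t_n)}$-orbit in $X_{B(t_n)}$. \end{enumerate}
   Context: The diagram $B(t_n)$: $V_n=\mathbb Z$ for every $n\in\mathbb N_0$; each $i\in V_n$ has exactly two outgoing edges in $E_n$, with ranges $i-t_n$ and $i+t_n$ in $V_{n+1}$; hence each $j\in V_{n+1}$ has exactly two incoming edges, with sources $j-t_n$ and $j+t_n$ in $V_n$. Left-to-right order: on $r^{-1}(j)$ the edge from $j-t_n$ is minimal and the edge from $j+t_n$ is maximal (its successor). $X_{B(t_n)}$ is the space of infinite paths $(x_n)_{n\ge0}$, $x_n\in E_n$, $r(x_n)=s(x_{n+1})$, with topology generated by the cylinder sets $[\overline e]$ of infinite paths beginning with a finite path $\overline e$ from $V_0$. A measure (non-atomic positive Borel) is tail invariant if $\mu([\overline e])=\mu([\overline e'])$ whenever $\overline e,\overline e'$ are finite paths from $V_0$ ending at the same vertex. A path is maximal (minimal) if all its edges are; for each $i\in V_0$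 there is exactly one infinite maximal path $\overline e_{\max}(i)$ and one infinite minimal path $\overline e_{\min}(i)$ starting at $i$. Vershik map: if $x$ is not maximal and $m$ is the least index with $x_m$ not maximal, then $\varphi_{B(t_n)}(x)=(g_0,\dots,g_{m-1},z,x_{m+1},x_{m+2},\dots)$, where $z$ is the successor of $x_m$ in $r^{-1}(r(x_m))$ and $(g_0,\dots,g_{m-1})$ is the minimal path from $V_0$ to $s(z)$; on maximal paths, $\varphi_{B(t_n)}(\overline e_{\max}(i))=\overline e_{\min}(i)$. An orbit is a set $\{\varphi^k_{B(t_n)}(x):k\in\mathbb Z\}$. *)

theory Defs
  imports "HOL-Probability.Probability"
begin

text \<open>
  All vertex sets are \<open>\<int>\<close>. An edge in \<open>E\<^sub>n\<close> is the pair of its source (in \<open>V\<^sub>n\<close>) and its range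
  (in \<open>V\<^sub>n\<^sub>+\<^sub>1\<close>); no multiplicities are lost, since the two edges leaving a vertex have distinct
  ranges as soon as \<open>t n > 0\<close>.
\<close>

type_synonym edge = "int \<times> int"

definition edges :: "(nat \<Rightarrow> nat) \<Rightarrow> nat \<Rightarrow> edge set" where
  "edges t n = {(i, j). j = i - int (t n) \<or> j = i + int (t n)}"

definition min_edge :: "(nat \<Rightarrow> nat) \<Rightarrow> nat \<Rightarrow> int \<Rightarrow> edge" where
  "min_edge t n j = (j - int (t n), j)"

definition max_edge :: "(nat \<Rightarrow> nat) \<Rightarrow> nat \<Rightarrow> int \<Rightarrow> edge" where
  "max_edge t n j = (j + int (t n), j)"

definition path_space :: "(nat \<Rightarrow> nat) \<Rightarrow> (nat \<Rightarrow> edge) set" where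
  "path_space t = {x. \<forall>n. x n \<in> edges t n \<and> snd (x n) = fst (x (Suc n))}"

definition finite_path :: "(nat \<Rightarrow> nat) \<Rightarrow> edge list \<Rightarrow> bool" where
  "finite_path t e \<longleftrightarrow> e \<noteq> [] \<and> (\<forall>k<length e. e ! k \<in> edges t k) \<and>
     (\<forall>k. Suc k < length e \<longrightarrow> snd (e ! k) = fst (e ! Suc k))"

text \<open>
  The paths of length 0 are left out: their cylinders are unions of cylinders of paths of
  length 1, and the condition of tail invariance is void for them.
\<close>

definition cylinder :: "(nat \<Rightarrow> nat) \<Rightarrow> edge list \<Rightarrow> (nat \<Rightarrow> edge) set" where
  "cylinder t e = {x \<in> path_space t. \<forall>k<length e. x k = e ! k}"

definition path_topology :: "(nat \<Rightarrow> nat) \<Rightarrow> (nat \<Rightarrow> edge) topology" where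
  "path_topology t = topology_generated_by {cylinder t e | e. finite_path t e}"

definition path_borel :: "(nat \<Rightarrow> nat) \<Rightarrow> (nat \<Rightarrow> edge) measure" where
  "path_borel t = sigma (path_space t) {U. openin (path_topology t) U}"

definition nonatomic :: "'a measure \<Rightarrow> bool" where
  "nonatomic M \<longleftrightarrow> (\<forall>A\<in>sets M. emeasure M A > 0 \<longrightarrow>
     (\<exists>B\<in>sets M. B \<subseteq> A \<and> 0 < emeasure M B \<and> emeasure M B < emeasure M A))"

text \<open>
  The sets \<open>V\<^sub>n\<close> are disjoint copies of \<open>\<int>\<close>, so two finite paths end at the same vertex only if
  they also have the same length.
\<close>

definition tail_invariant :: "(nat \<Rightarrow> nat) \<Rightarrow> (nat \<Rightarrow> edge) measure \<Rightarrow> bool" where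
  "tail_invariant t M \<longleftrightarrow> sets M = sets (path_borel t) \<and> nonatomic M \<and>
     (\<forall>e e'. finite_path t e \<and> finite_path t e' \<and> length e = length e' \<and>
        snd (last e) = snd (last e') \<longrightarrow>
        emeasure M (cylinder t e) = emeasure M (cylinder t e'))"

definition maximal_path :: "(nat \<Rightarrow> nat) \<Rightarrow> (nat \<Rightarrow> edge) \<Rightarrow> bool" where
  "maximal_path t x \<longleftrightarrow> (\<forall>n. x n = max_edge t n (snd (x n)))"

definition minimal_path :: "(nat \<Rightarrow> nat) \<Rightarrow> (nat \<Rightarrow> edge) \<Rightarrow> bool" where
  "minimal_path t x \<longleftrightarrow> (\<forall>n. x n = min_edge t n (snd (x n)))"

definition e_min :: "(nat \<Rightarrow> nat) \<Rightarrow> int \<Rightarrow> nat \<Rightarrow> edge" where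
  "e_min t i = (THE x. x \<in> path_space t \<and> minimal_path t x \<and> fst (x 0) = i)"

lemma ex1_minimal_path: "\<exists>!x. x \<in> path_space t \<and> minimal_path t x \<and> fst (x 0) = i"
proof -
  define y where "y n = (i + (\<Sum>k<n. int (t k)), i + (\<Sum>k<Suc n. int (t k)))" for n
  have "y \<in> path_space t \<and> minimal_path t y \<and> fst (y 0) = i"
    by (auto simp: y_def path_space_def minimal_path_def min_edge_def edges_def)
  moreover have "x = y"
    if x: "x \<in> path_space t \<and> minimal_path t x \<and> fst (x 0) = i" for x
  proof -
    have step: "snd (x n) = fst (x n) + int (t n)" for n
      using x unfolding minimal_path_def min_edge_def
      by (metis diff_add_cancel fst_conv)
    have link: "fst (x (Suc n)) = snd (x n)" for n
      using x by (simp add: path_space_def)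
    have fst_x: "fst (x n) = i + (\<Sum>k<n. int (t k))" for n
      by (induction n) (use x link step in auto)
    show "x = y"
      by (rule ext, rule prod_eqI) (simp_all add: y_def step fst_x)
  qed
  ultimately show ?thesis by blast
qed

text \<open>The minimal finite path from \<open>V\<^sub>0\<close> to the vertex \<open>v \<in> V\<^sub>m\<close>, built backwards from \<open>v\<close>.\<close>

primrec min_finite_path :: "(nat \<Rightarrow> nat) \<Rightarrow> nat \<Rightarrow> int \<Rightarrow> edge list" where
  "min_finite_path t 0 v = []"
| "min_finite_path t (Suc m) v =
     min_finite_path t m (fst (min_edge t m v)) @ [min_edge t m v]"

text \<open>
  Each \<open>r\<inverse>(j)\<close> consists of the minimal and the maximal edge only, so the successor of a
  non-maximal edge with range \<open>j\<close> is the maximal edge with range \<open>j\<close>.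
\<close>

definition vershik :: "(nat \<Rightarrow> nat) \<Rightarrow> (nat \<Rightarrow> edge) \<Rightarrow> nat \<Rightarrow> edge" where
  "vershik t x =
     (if maximal_path t x then e_min t (fst (x 0))
      else let m = (LEAST m. x m \<noteq> max_edge t m (snd (x m)));
               z = max_edge t m (snd (x m));
               g = min_finite_path t m (fst z)
           in (\<lambda>n. if n < m then g ! n else if n = m then z else x n))"

text \<open>
  If all \<open>t n\<close> are positive, the Vershik map is a bijection of the path space, and
  \<open>inv_into\<close> gives its negative powers.
\<close>

definition vershik_power :: "(nat \<Rightarrow> nat) \<Rightarrow> int \<Rightarrow> (nat \<Rightarrow> edge) \<Rightarrow> nat \<Rightarrow> edge" where
  "vershik_power t k =
     (if k \<ge> 0 then vershik t ^^ nat k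
      else inv_into (path_space t) (vershik t) ^^ nat (- k))"

definition vershik_orbit :: "(nat \<Rightarrow> nat) \<Rightarrow> (nat \<Rightarrow> edge) \<Rightarrow> (nat \<Rightarrow> edge) set" where
  "vershik_orbit t x = {vershik_power t k x | k. True}"

end

theory Submission
  imports Defs
begin

text \<open>
  A path is coded by its starting vertex and its sequence of signs, \<open>True\<close> for \<open>+\<close>. The growth
  condition says that \<open>t\<close> is superincreasing, so distinct sign vectors of length \<open>n\<close> have distinct
  signed sums.

  For a sign vector \<open>a\<close> of length \<open>n\<close>, the cylinder \<open>(i, a)\<close> has the same measure as each of the
  \<open>2\<^sup>n\<close> cylinders \<open>(i', b)\<close> that end at the same vertex. Since \<open>i'\<close> and \<open>b\<close> determine \<open>a\<close>, all these
  cylinders, for all \<open>a\<close> and \<open>b\<close>, are disjoint. Hence the set of paths starting at \<open>i\<close> has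
  measure at most \<open>1 / 2\<^sup>n\<close> for all \<open>n\<close>.

  The Vershik map is the odometer on the signs and moves the starting vertex to the right by \<open>L\<^sub>m > 0\<close>,
  except that it keeps the starting vertex of a maximal path; but a minimal path is not maximal.
  An orbit therefore has at most two points with a given starting vertex, while a dense orbit
  has to visit all four cylinders of length 2 with that starting vertex.
\<close>

section \<open>Paths in sign coordinates\<close>

definition vtx :: "(nat \<Rightarrow> nat) \<Rightarrow> int \<Rightarrow> (nat \<Rightarrow> bool) \<Rightarrow> nat \<Rightarrow> int" where
  "vtx t i s n = i + (\<Sum>k<n. if s k then int (t k) else - int (t k))"

definition signed_path :: "(nat \<Rightarrow> nat) \<Rightarrow> int \<Rightarrow> (nat \<Rightarrow> bool) \<Rightarrow> nat \<Rightarrow> edge" where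
  "signed_path t i s n = (vtx t i s n, vtx t i s (Suc n))"

text \<open>A sign vector of length \<open>n\<close> is encoded by the set \<open>A\<close> of
  positions of its plus signs, so that \<open>Pow {..<n}\<close> enumerates all of them. Only the
  part of \<open>A\<close> below \<open>n\<close> matters.\<close>

definition sign_cylinder :: "(nat \<Rightarrow> nat) \<Rightarrow> nat \<Rightarrow> int \<Rightarrow> nat set \<Rightarrow> (nat \<Rightarrow> edge) set" where
  "sign_cylinder t n i A = {signed_path t i s | s. \<forall>k<n. s k \<longleftrightarrow> k \<in> A}"

lemma vtx_0 [simp]: "vtx t i s 0 = i"
  by (simp add: vtx_def)

lemma vtx_Suc [simp]:
  "vtx t i s (Suc n) = vtx t i s n + (if s n then int (t n) else - int (t n))"
  by (simp add: vtx_def)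

lemma vtx_cong: "(\<And>k. k < n \<Longrightarrow> s k = s' k) \<Longrightarrow> vtx t i s n = vtx t i s' n"
  by (simp add: vtx_def)

lemma vtx_shift: "vtx t i s n = i + vtx t 0 s n"
  by (simp add: vtx_def)

lemma vtx_all_plus: "(\<And>k. k < n \<Longrightarrow> s k) \<Longrightarrow> vtx t i s n = i + (\<Sum>k<n. int (t k))"
  by (simp add: vtx_def)

lemma vtx_all_minus: "(\<And>k. k < n \<Longrightarrow> \<not> s k) \<Longrightarrow> vtx t i s n = i - (\<Sum>k<n. int (t k))"
  by (simp add: vtx_def sum_negf)

lemma signed_path_in_path_space: "signed_path t i s \<in> path_space t"
  by (auto simp: path_space_def signed_path_def edges_def)

lemma path_space_imp_signed_path:
  assumes "x \<in> path_space t"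
  obtains s where "x = signed_path t (fst (x 0)) s"
proof -
  define s where "s n \<longleftrightarrow> snd (x n) = fst (x n) + int (t n)" for n
  have step: "snd (x n) = fst (x n) + (if s n then int (t n) else - int (t n))" for n
  proof -
    have "x n \<in> edges t n" using assms by (simp add: path_space_def)
    thus ?thesis by (auto simp: edges_def s_def)
  qed
  have link: "fst (x (Suc n)) = snd (x n)" for n
    using assms by (simp add: path_space_def)
  define i where "i = fst (x 0)"
  have "fst (x n) = vtx t i s n" for n
    by (induction n) (simp_all add: link step i_def)
  hence "x = signed_path t i s"
    by (intro ext prod_eqI) (simp_all add: signed_path_def step)
  thus ?thesis unfolding i_def by (rule that)
qed

text \<open>The two edges that leave a vertex differ by \<open>2 * t k\<close> in their ranges, so
  positivity makes the sign readable from the edge.\<close>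

lemma signed_path_sign:
  assumes "t k > 0" "signed_path t i s k = signed_path t i' s' k"
  shows "s k = s' k"
  using assms by (auto simp: signed_path_def split: if_splits)

lemma fst_signed_path_0 [simp]: "fst (signed_path t i s 0) = i"
  by (simp add: signed_path_def)

lemma signed_path_eq_iff:
  assumes "\<And>n. t n > 0"
  shows "signed_path t i s = signed_path t i' s' \<longleftrightarrow> i = i' \<and> s = s'"
proof
  assume eq: "signed_path t i s = signed_path t i' s'"
  have "i = i'" using arg_cong[OF eq, of "\<lambda>x. fst (x 0)"] by simp
  moreover have "s = s'"
    using signed_path_sign[of t _ i s i' s'] assms eq by auto
  ultimately show "i = i' \<and> s = s'" by simp
qed simp

lemma finite_path_signed:
  assumes "n > 0"
  shows "finite_path t (map (signed_path t i s) [0..<n])"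
  using assms by (auto simp: finite_path_def signed_path_def edges_def)

text \<open>The starting vertex is read off from the first edge, hence \<open>n > 0\<close>: the
  empty list would give the whole path space, whereas \<open>sign_cylinder t 0 i A\<close> still
  fixes the vertex \<open>i\<close>.\<close>

lemma cylinder_signed:
  assumes "\<And>n. t n > 0" "n > 0"
  shows "cylinder t (map (signed_path t i (\<lambda>k. k \<in> A)) [0..<n]) = sign_cylinder t n i A"
proof (intro equalityI subsetI)
  fix x assume x: "x \<in> cylinder t (map (signed_path t i (\<lambda>k. k \<in> A)) [0..<n])"
  then obtain s where s: "x = signed_path t (fst (x 0)) s"
    by (auto simp: cylinder_def elim: path_space_imp_signed_path)
  have eq: "x k = signed_path t i (\<lambda>k. k \<in> A) k" if "k < n" for k
    using x that by (auto simp: cylinder_def)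
  have "fst (x 0) = i" using eq[of 0] assms by simp
  moreover have "s k \<longleftrightarrow> k \<in> A" if "k < n" for k
    using signed_path_sign[of t k "fst (x 0)" s i "\<lambda>k. k \<in> A"] eq[OF that] s assms(1) by metis
  ultimately show "x \<in> sign_cylinder t n i A"
    using s unfolding sign_cylinder_def by blast
next
  fix x assume "x \<in> sign_cylinder t n i A"
  then obtain s where s: "x = signed_path t i s" "\<forall>k<n. s k \<longleftrightarrow> k \<in> A"
    by (auto simp: sign_cylinder_def)
  have "x k = signed_path t i (\<lambda>k. k \<in> A) k" if "k < n" for k
    using s that vtx_cong[of k s "\<lambda>k. k \<in> A"] by (simp add: signed_path_def)
  thus "x \<in> cylinder t (map (signed_path t i (\<lambda>k. k \<in> A)) [0..<n])"
    using signed_path_in_path_space s(1) by (auto simp: cylinder_def)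
qed

section \<open>Topology and Borel sets of the path space\<close>

lemma cylinder_subset: "cylinder t e \<subseteq> path_space t"
  by (auto simp: cylinder_def)

lemma openin_cylinder: "finite_path t e \<Longrightarrow> openin (path_topology t) (cylinder t e)"
  unfolding path_topology_def by (rule topology_generated_by_Basis) blast

lemma topspace_path_topology: "topspace (path_topology t) = path_space t"
proof -
  have "x \<in> cylinder t (map (signed_path t i s) [0..<1])" if "x = signed_path t i s" for x i s
    using that signed_path_in_path_space by (auto simp: cylinder_def)
  hence "\<exists>e. finite_path t e \<and> x \<in> cylinder t e" if "x \<in> path_space t" for x
    using that finite_path_signed[of 1 t] by (metis path_space_imp_signed_path zero_less_one)
  thus ?thesis
    unfolding path_topology_def topology_generated_by_topspace
    by (blast intro: cylinder_subset[THEN subsetD])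
qed

lemma openin_imp_sets_path_borel:
  "openin (path_topology t) U \<Longrightarrow> U \<in> sets (path_borel t)"
  and space_path_borel: "space (path_borel t) = path_space t"
proof -
  have sub: "{U. openin (path_topology t) U} \<subseteq> Pow (path_space t)"
    using openin_subset topspace_path_topology by fastforce
  show "openin (path_topology t) U \<Longrightarrow> U \<in> sets (path_borel t)"
    unfolding path_borel_def sets_measure_of[OF sub] by (auto intro: sigma_sets.Basic)
  show "space (path_borel t) = path_space t"
    unfolding path_borel_def by (rule space_measure_of[OF sub])
qed

section \<open>Superincreasing signed sums and tail invariant probability measures\<close>

lemma abs_vtx_le: "\<bar>vtx t 0 s n\<bar> \<le> (\<Sum>k<n. int (t k))"
  by (induction n) auto

text \<open>The last term outweighs all earlier ones together, so its sign is the sign of the whole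
  sum. Removing it leaves the same problem for a shorter sum.\<close>

lemma vtx_inj:
  assumes "\<And>n. (\<Sum>k<n. t k) < t n" "vtx t 0 s n = vtx t 0 s' n" "k < n"
  shows "s k = s' k"
  using assms(2,3)
proof (induction n arbitrary: k)
  case (Suc n)
  have "(\<Sum>k<n. int (t k)) < int (t n)"
    using assms(1)[of n] by (metis of_nat_less_iff of_nat_sum)
  hence n: "s n = s' n"
    using Suc.prems(1) abs_vtx_le[of t s n] abs_vtx_le[of t s' n] by (auto split: if_splits)
  show ?case using Suc n by (cases "k = n") auto
qed simp

lemma sign_cylinder_disjoint:
  assumes "\<And>n. t n > 0" "sign_cylinder t n i A \<inter> sign_cylinder t n i' A' \<noteq> {}"
    "A \<subseteq> {..<n}" "A' \<subseteq> {..<n}"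
  shows "i = i' \<and> A = A'"
proof -
  obtain s s' where "signed_path t i s = signed_path t i' s'"
    and s: "\<forall>k<n. s k \<longleftrightarrow> k \<in> A" "\<forall>k<n. s' k \<longleftrightarrow> k \<in> A'"
    using assms(2) by (auto simp: sign_cylinder_def)
  hence "i = i'" "s = s'" using signed_path_eq_iff[of t, OF assms(1)] by simp_all
  with s assms(3,4) show ?thesis by (auto simp: subset_eq)
qed

lemma start_eq_Union_sign_cylinder:
  "{x \<in> path_space t. fst (x 0) = i} = (\<Union>A\<in>Pow {..<n}. sign_cylinder t n i A)"
proof (intro equalityI subsetI)
  fix x assume "x \<in> {x \<in> path_space t. fst (x 0) = i}"
  then obtain s where "x = signed_path t i s" by (auto elim: path_space_imp_signed_path)
  hence "x \<in> sign_cylinder t n i {k. k < n \<and> s k}" by (auto simp: sign_cylinder_def)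
  moreover have "{k. k < n \<and> s k} \<in> Pow {..<n}" by auto
  ultimately show "x \<in> (\<Union>A\<in>Pow {..<n}. sign_cylinder t n i A)" by (rule UN_I[rotated])
qed (auto simp: sign_cylinder_def signed_path_in_path_space)

lemma measure_start_le:
  assumes inc: "\<And>n. (\<Sum>k<n. t k) < t n"
    and M: "tail_invariant t M" "prob_space M" and n: "n > 0"
  shows "2 ^ n * measure M {x \<in> path_space t. fst (x 0) = i} \<le> 1"
proof -
  interpret prob_space M by fact
  have pos: "t n > 0" for n using inc[of n] by simp
  define v where "v A = vtx t 0 (\<lambda>k. k \<in> A) n" for A
  define C where "C = sign_cylinder t n"
  have sets: "C j A \<in> sets M" for j A
    using M(1) openin_imp_sets_path_borel[OF openin_cylinder[OF finite_path_signed[OF n]]]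
    unfolding C_def cylinder_signed[OF pos n, symmetric] by (simp add: tail_invariant_def)
  have v_inj: "A = A'" if "v A = v A'" "A \<subseteq> {..<n}" "A' \<subseteq> {..<n}" for A A'
    using vtx_inj[OF inc that(1)[unfolded v_def]] that(2,3) by blast
  have disj: "j = j' \<and> A = A'" if "C j A \<inter> C j' A' \<noteq> {}" "A \<subseteq> {..<n}" "A' \<subseteq> {..<n}" for j j' A A'
    using sign_cylinder_disjoint[OF pos that(1)[unfolded C_def] that(2,3)] .
  have disjC: "disjoint_family_on (C j) (Pow {..<n})" for j
    unfolding disjoint_family_on_def using disj by blast
  \<comment> \<open>The starting vertex \<open>i + v A - v B\<close> is the one from which the signs
    \<open>B\<close> lead to \<open>i + v A\<close>, the end of the cylinder
    \<open>(i, A)\<close>.\<close>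
  have inv: "measure M (C i A) = measure M (C (i + v A - v B) B)" for A B
  proof -
    let ?e = "\<lambda>i A. map (signed_path t i (\<lambda>k. k \<in> A)) [0..<n]"
    have last: "snd (last (?e j A)) = j + v A" for j A
      using n vtx_shift[of t j "\<lambda>k. k \<in> A" n]
      by (cases n) (simp_all add: v_def signed_path_def last_map)
    have "emeasure M (cylinder t (?e i A)) = emeasure M (cylinder t (?e (i + v A - v B) B))"
      using M(1) finite_path_signed[OF n] last unfolding tail_invariant_def by auto
    thus ?thesis unfolding C_def cylinder_signed[OF pos n] by (simp add: measure_def)
  qed
  define I where "I = Pow {..<n} \<times> Pow {..<n}"
  \<comment> \<open>The pair \<open>(A, B)\<close> stands for the companion of the cylinder
    \<open>(i, A)\<close> with signs \<open>B\<close>. A path in it reveals its starting vertex and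
    \<open>B\<close>, hence \<open>v A\<close>, and \<open>v_inj\<close> recovers
    \<open>A\<close>.\<close>
  define D where "D = (\<lambda>(A, B). C (i + v A - v B) B)"
  have fin: "finite I" by (simp add: I_def)
  have disjD: "disjoint_family_on D I"
    unfolding disjoint_family_on_def
  proof (intro ballI impI)
    fix p q assume pq: "p \<in> I" "q \<in> I" "p \<noteq> q"
    obtain A B A' B' where p: "p = (A, B)" and q: "q = (A', B')" by (cases p, cases q)
    show "D p \<inter> D q = {}"
    proof (rule ccontr)
      assume "D p \<inter> D q \<noteq> {}"
      hence "C (i + v A - v B) B \<inter> C (i + v A' - v B') B' \<noteq> {}" by (simp add: D_def p q)
      hence "i + v A - v B = i + v A' - v B' \<and> B = B'"
        by (rule disj) (use pq in \<open>auto simp: p q I_def\<close>)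
      hence B: "B = B'" and "v A = v A'" by auto
      with v_inj[of A A'] pq show False by (auto simp: p q I_def)
    qed
  qed
  have "2 ^ n * measure M {x \<in> path_space t. fst (x 0) = i}
      = 2 ^ n * (\<Sum>A\<in>Pow {..<n}. measure M (C i A))"
    unfolding start_eq_Union_sign_cylinder[of t i n] C_def[symmetric] using sets disjC
    by (subst finite_measure_finite_Union) auto
  \<comment> \<open>The factor \<open>2 ^ n\<close> is the number of sets \<open>B\<close> and
    becomes an inner sum of constant terms.\<close>
  also have "\<dots> = (\<Sum>A\<in>Pow {..<n}. \<Sum>B\<in>Pow {..<n}. measure M (C i A))"
    by (simp add: card_Pow sum_distrib_left)
  also have "\<dots> = (\<Sum>A\<in>Pow {..<n}. \<Sum>B\<in>Pow {..<n}. measure M (C (i + v A - v B) B))"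
    by (intro sum.cong refl inv)
  also have "\<dots> = (\<Sum>p\<in>I. measure M (D p))"
    unfolding I_def D_def by (simp add: sum.cartesian_product case_prod_unfold)
  also have "\<dots> = measure M (\<Union>p\<in>I. D p)"
    using fin disjD sets by (subst finite_measure_finite_Union) (auto simp: D_def)
  also have "\<dots> \<le> 1" by simp
  finally show ?thesis .
qed

text \<open>The bounds for all \<open>n\<close> make each set of paths with a fixed start null.
  There are countably many starting vertices, so the whole space would be null.\<close>

lemma no_tail_invariant_prob:
  assumes inc: "\<And>n. (\<Sum>k<n. t k) < t n" and M: "tail_invariant t M" "prob_space M"
  shows False
proof -
  interpret prob_space M by fact
  define S where "S i = {x \<in> path_space t. fst (x 0) = i}" for i :: int
  have pos: "t n > 0" for n using inc[of n] by simp
  have "sign_cylinder t 1 i A \<in> sets M" for i A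
    using M(1) openin_imp_sets_path_borel[OF openin_cylinder[OF finite_path_signed[of 1]]]
    unfolding cylinder_signed[OF pos zero_less_one, symmetric] by (simp add: tail_invariant_def)
  hence sets: "S i \<in> sets M" for i
    unfolding S_def start_eq_Union_sign_cylinder[of t i 1] by auto
  have "measure M (S i) = 0" for i
  proof (rule ccontr)
    assume "measure M (S i) \<noteq> 0"
    hence p: "measure M (S i) > 0" by (simp add: zero_less_measure_iff)
    obtain n where n: "1 / measure M (S i) < 2 ^ n"
      using real_arch_pow[of 2 "1 / measure M (S i)"] by auto
    \<comment> \<open>Passing to \<open>Suc n\<close> secures the positive length that
      \<open>measure_start_le\<close> asks for.\<close>
    have "2 ^ n \<le> (2::real) ^ Suc n" by simp
    with n have "1 / measure M (S i) < 2 ^ Suc n" by linarith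
    hence "1 < 2 ^ Suc n * measure M (S i)" using p by (simp add: divide_less_eq)
    thus False using measure_start_le[OF inc M, of "Suc n" i] by (simp add: S_def)
  qed
  hence "S i \<in> null_sets M" for i
    using sets by (auto simp: emeasure_eq_measure)
  hence "(\<Union>i. S i) \<in> null_sets M" by (intro null_sets_UN) auto
  moreover have "(\<Union>i. S i) = space M"
    using M(1) sets_eq_imp_space_eq[of M "path_borel t"] space_path_borel
    by (auto simp: S_def tail_invariant_def)
  ultimately show False using emeasure_space_1 by auto
qed

section \<open>The Vershik map as an odometer on the signs\<close>

lemma min_finite_path_nth:
  "n < m \<Longrightarrow> min_finite_path t m v ! n =
     (v - (\<Sum>k<m. int (t k)) + (\<Sum>k<n. int (t k)), v - (\<Sum>k<m. int (t k)) + (\<Sum>k<Suc n. int (t k)))"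
proof (induction m arbitrary: v)
  case (Suc m)
  have len: "length (min_finite_path t m w) = m" for w
    by (induction m arbitrary: w) simp_all
  show ?case
  proof (cases "n = m")
    case True thus ?thesis using len[of "v - int (t m)"] by (simp add: min_edge_def nth_append)
  next
    case False
    hence "n < m" using Suc.prems by simp
    thus ?thesis using Suc.IH[of "v - int (t m)"] len by (simp add: min_edge_def nth_append)
  qed
qed simp

text \<open>The maximal edge comes from the right and so decreases the vertex: minus is the maximal
  sign, plus the minimal one.\<close>

lemma signed_path_max_edge:
  "t n > 0 \<Longrightarrow> signed_path t i s n = max_edge t n (snd (signed_path t i s n)) \<longleftrightarrow> \<not> s n"
  by (simp add: signed_path_def max_edge_def)

lemma vershik_maximal:
  assumes "\<And>n. t n > 0"
  shows "vershik t (signed_path t i (\<lambda>_. False)) = signed_path t i (\<lambda>_. True)"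
proof -
  have "minimal_path t (signed_path t i (\<lambda>_. True))"
    by (simp add: minimal_path_def min_edge_def signed_path_def)
  hence "e_min t i = signed_path t i (\<lambda>_. True)"
    unfolding e_min_def
    by (intro the1_equality[OF ex1_minimal_path]) (simp add: signed_path_in_path_space)
  thus ?thesis using assms by (simp add: vershik_def maximal_path_def signed_path_max_edge)
qed

lemma vershik_nonmaximal:
  assumes pos: "\<And>n. t n > 0" and m: "s m" "\<And>k. k < m \<Longrightarrow> \<not> s k"
  shows "vershik t (signed_path t i s) =
    signed_path t (i + 2 * (int (t m) - (\<Sum>k<m. int (t k)))) (\<lambda>n. n < m \<or> n > m \<and> s n)"
    (is "_ = signed_path t ?j ?s'")
proof -
  let ?z = "max_edge t m (snd (signed_path t i s m))"
  have least: "(LEAST m. signed_path t i s m \<noteq> max_edge t m (snd (signed_path t i s m))) = m"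
    unfolding signed_path_max_edge[of t, OF pos] using m
    by (intro Least_equality) (auto simp: not_less[symmetric])
  have nonmax: "\<not> maximal_path t (signed_path t i s)"
    using m by (auto simp: maximal_path_def signed_path_max_edge[of t, OF pos])
  have vm: "vtx t i s m = i - (\<Sum>k<m. int (t k))" using m(2) by (rule vtx_all_minus)
  have lo: "vtx t ?j ?s' n = ?j + (\<Sum>k<n. int (t k))" if "n \<le> m" for n
    using that by (intro vtx_all_plus) auto
  \<comment> \<open>Both paths meet at the range of edge \<open>m\<close> and have the same signs
    from there on.\<close>
  have hi: "vtx t ?j ?s' (Suc m + d) = vtx t i s (Suc m + d)" for d
  proof (induction d)
    case 0 thus ?case using lo[of m] vm m(1) by simp
  qed simp
  have z: "?z = (i - (\<Sum>k<m. int (t k)) + 2 * int (t m), vtx t i s (Suc m))"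
    using vm m(1) by (simp add: max_edge_def signed_path_def)
  have "(if n < m then min_finite_path t m (fst ?z) ! n else if n = m then ?z
         else signed_path t i s n) = signed_path t ?j ?s' n" for n
  proof -
    consider "n < m" | "n = m" | d where "n = Suc m + d"
      by (metis less_imp_Suc_add linorder_neqE_nat add_Suc)
    thus ?thesis
    proof cases
      case 1 thus ?thesis
        using lo[of n] lo[of "Suc n"] min_finite_path_nth[OF 1, of t "fst ?z"] z
        by (simp add: signed_path_def del: vtx_Suc)
    next
      case 2 thus ?thesis using lo[of m] hi[of 0] z by (simp add: signed_path_def del: vtx_Suc)
    next
      case 3 thus ?thesis
        using hi[of d] hi[of "Suc d"] by (simp add: signed_path_def del: vtx_Suc)
    qed
  qed
  thus ?thesis unfolding vershik_def Let_def least using nonmax by auto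
qed

lemma vershik_in_path_space:
  assumes "\<And>n. t n > 0" "x \<in> path_space t"
  shows "vershik t x \<in> path_space t"
proof -
  obtain s where s: "x = signed_path t (fst (x 0)) s"
    using assms(2) by (rule path_space_imp_signed_path)
  show ?thesis
  proof (cases "\<exists>n. s n")
    case True
    then obtain m where "s m" "\<And>k. k < m \<Longrightarrow> \<not> s k" using exists_least_iff[of s] by auto
    from vershik_nonmaximal[of t s m "fst (x 0)", OF assms(1) this] show ?thesis
      by (simp add: s[symmetric] signed_path_in_path_space)
  next
    case False
    hence "s = (\<lambda>_. False)" by auto
    hence "vershik t x = signed_path t (fst (x 0)) (\<lambda>_. True)"
      by (subst s) (simp add: vershik_maximal[OF assms(1)])
    thus ?thesis by (simp add: signed_path_in_path_space)
  qed
qed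

text \<open>The odometer is run backwards. Surjectivity makes \<open>inv_into\<close> a right
  inverse of the map that stays in the path space, which is what the negative powers rely
  on.\<close>

lemma vershik_surj:
  assumes "\<And>n. t n > 0"
  shows "path_space t \<subseteq> vershik t ` path_space t"
proof
  fix y assume "y \<in> path_space t"
  then obtain r where r: "y = signed_path t (fst (y 0)) r" by (rule path_space_imp_signed_path)
  show "y \<in> vershik t ` path_space t"
  proof (cases "\<exists>n. \<not> r n")
    case True
    then obtain m where m: "\<not> r m" "\<And>k. k < m \<Longrightarrow> r k"
      using exists_least_iff[of "\<lambda>n. \<not> r n"] by auto
    \<comment> \<open>The first minus of \<open>r\<close> becomes plus and the plus signs before it
      become minus; \<open>i\<close> undoes the shift of the start.\<close>
    define s where "s n \<longleftrightarrow> n = m \<or> n > m \<and> r n" for n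
    define i where "i = fst (y 0) - 2 * (int (t m) - (\<Sum>k<m. int (t k)))"
    have "(n < m \<or> n > m \<and> s n) = r n" for n
      using m by (cases n m rule: linorder_cases) (simp_all add: s_def)
    hence "(\<lambda>n. n < m \<or> n > m \<and> s n) = r" by (rule ext)
    hence "vershik t (signed_path t i s) = signed_path t (fst (y 0)) r"
      using vershik_nonmaximal[of t s m i, OF assms] by (simp add: s_def i_def)
    hence "vershik t (signed_path t i s) = y" by (subst r)
    thus ?thesis using signed_path_in_path_space by blast
  next
    case False
    hence "r = (\<lambda>_. True)" by auto
    hence "y = vershik t (signed_path t (fst (y 0)) (\<lambda>_. False))"
      by (subst r) (simp add: vershik_maximal[OF assms])
    thus ?thesis using signed_path_in_path_space by blast
  qed
qed

lemma vershik_start: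
  assumes inc: "\<And>n. (\<Sum>k<n. t k) < t n" and x: "x \<in> path_space t"
  shows "fst (x 0) \<le> fst (vershik t x 0)"
    and "fst (x 0) < fst (vershik t (vershik t x) 0)"
proof -
  have pos: "t n > 0" for n using inc[of n] by simp
  have incr: "i < fst (vershik t (signed_path t i s) 0)" if "s n" for i s n
  proof -
    from that obtain m where m: "s m" "\<And>k. k < m \<Longrightarrow> \<not> s k"
      using exists_least_iff[of s] by auto
    have "(\<Sum>k<m. int (t k)) < int (t m)"
      using inc[of m] by (metis of_nat_less_iff of_nat_sum)
    thus ?thesis by (simp add: vershik_nonmaximal[of t s m, OF pos m])
  qed
  \<comment> \<open>The start is kept only at the all-minus path, whose image is the all-plus path;
    that one has a plus at position 0, so the next step moves right.\<close>
  have dichotomy: "fst (x 0) < fst (vershik t x 0) \<or>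
      vershik t x = signed_path t (fst (x 0)) (\<lambda>_. True)" if x: "x \<in> path_space t" for x
  proof -
    obtain s where s: "x = signed_path t (fst (x 0)) s"
      using x by (rule path_space_imp_signed_path)
    show ?thesis
    proof (cases "\<exists>n. s n")
      case True
      then obtain n where "s n" ..
      from incr[of s n "fst (x 0)", OF this] show ?thesis by (simp add: s[symmetric])
    next
      case False
      hence "s = (\<lambda>_. False)" by auto
      hence "vershik t x = signed_path t (fst (x 0)) (\<lambda>_. True)"
        by (subst s) (simp add: vershik_maximal[OF pos])
      thus ?thesis ..
    qed
  qed
  have le: "fst (x 0) \<le> fst (vershik t x 0)" if "x \<in> path_space t" for x
    using dichotomy[OF that] by auto
  show "fst (x 0) \<le> fst (vershik t x 0)" by (rule le[OF x])
  show "fst (x 0) < fst (vershik t (vershik t x) 0)"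
    using dichotomy[OF x]
  proof
    assume "fst (x 0) < fst (vershik t x 0)"
    thus ?thesis using le[OF vershik_in_path_space[OF pos x]] by linarith
  next
    assume "vershik t x = signed_path t (fst (x 0)) (\<lambda>_. True)"
    thus ?thesis using incr[of "\<lambda>_. True" 0 "fst (x 0)"] by simp
  qed
qed

section \<open>Integer powers of the Vershik map and density of orbits\<close>

lemma vershik_power_in_path_space:
  assumes pos: "\<And>n. t n > 0" and x: "x \<in> path_space t"
  shows "vershik_power t k x \<in> path_space t"
proof -
  have "(vershik t ^^ n) x \<in> path_space t" for n
    by (induction n) (use x vershik_in_path_space[OF pos] in auto)
  moreover have "(inv_into (path_space t) (vershik t) ^^ n) x \<in> path_space t" for n
    by (induction n) (use x vershik_surj[of t, OF pos] in \<open>auto intro!: inv_into_into\<close>)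
  ultimately show ?thesis by (simp add: vershik_power_def)
qed

lemma vershik_power_add_1:
  assumes pos: "\<And>n. t n > 0" and x: "x \<in> path_space t"
  shows "vershik_power t (k + 1) x = vershik t (vershik_power t k x)"
proof (cases "k \<ge> 0")
  case True
  thus ?thesis by (simp add: vershik_power_def nat_add_distrib)
next
  case False
  define f where "f = inv_into (path_space t) (vershik t)"
  define n where "n = nat (- (k + 1))"
  have k: "k = - int (Suc n)" using False by (simp add: n_def)
  \<comment> \<open>If \<open>n = 0\<close>, the exponent \<open>k + 1\<close> is 0 and falls under
    the nonnegative branch of \<open>vershik_power\<close>; hence the case split.\<close>
  have shift: "vershik_power t (k + 1) x = (f ^^ n) x"
    by (cases n) (simp_all add: vershik_power_def f_def k nat_add_distrib)
  have "(f ^^ n) x \<in> vershik t ` path_space t"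
    using vershik_surj[of t, OF pos] vershik_power_in_path_space[of t x "k + 1", OF pos x]
    unfolding shift by blast
  hence "vershik t (f ((f ^^ n) x)) = (f ^^ n) x"
    unfolding f_def by (rule f_inv_into_f)
  thus ?thesis unfolding shift by (simp add: vershik_power_def k f_def nat_add_distrib)
qed

text \<open>The gap of 2 allows for one step that keeps the starting vertex; two consecutive steps
  always move it, and further steps never move it back.\<close>

lemma vershik_power_start_less:
  assumes inc: "\<And>n. (\<Sum>k<n. t k) < t n" and x: "x \<in> path_space t" and kl: "k + 2 \<le> l"
  shows "fst (vershik_power t k x 0) < fst (vershik_power t l x 0)"
proof -
  have pos: "t n > 0" for n using inc[of n] by simp
  note mem = vershik_power_in_path_space[OF pos x] and add_1 = vershik_power_add_1[OF pos x]
  show ?thesis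
    using kl
  proof (induction l rule: int_ge_induct)
    case base
    show ?case using vershik_start(2)[OF inc mem[of k]] add_1[of k] add_1[of "k + 1"]
      by (simp add: add.commute)
  next
    case (step l)
    thus ?case using vershik_start(1)[OF inc mem[of l]] add_1[of l] by simp
  qed
qed

lemma no_dense_orbit:
  assumes inc: "\<And>n. (\<Sum>k<n. t k) < t n" and x: "x \<in> path_space t"
  shows "path_topology t closure_of vershik_orbit t x \<noteq> path_space t"
proof
  assume dense: "path_topology t closure_of vershik_orbit t x = path_space t"
  have pos: "t n > 0" for n using inc[of n] by simp
  \<comment> \<open>Length 2 provides more disjoint cylinders at the vertex 0 than the two that
    consecutive exponents could visit.\<close>
  have "\<exists>k. vershik_power t k x \<in> sign_cylinder t 2 0 A" for A
  proof -
    have "signed_path t 0 (\<lambda>k. k \<in> A) \<in> sign_cylinder t 2 0 A"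
      by (auto simp: sign_cylinder_def)
    moreover have "openin (path_topology t) (sign_cylinder t 2 0 A)"
      unfolding cylinder_signed[OF pos zero_less_numeral, symmetric]
      by (intro openin_cylinder finite_path_signed) simp
    moreover have "signed_path t 0 (\<lambda>k. k \<in> A) \<in> path_topology t closure_of vershik_orbit t x"
      by (simp add: dense signed_path_in_path_space)
    ultimately have "\<exists>y\<in>vershik_orbit t x. y \<in> sign_cylinder t 2 0 A"
      unfolding in_closure_of by blast
    thus ?thesis by (auto simp: vershik_orbit_def)
  qed
  then obtain K where K: "\<And>A. vershik_power t (K A) x \<in> sign_cylinder t 2 0 A" by metis
  have start: "fst (vershik_power t (K A) x 0) = 0" for A
    using K[of A] by (auto simp: sign_cylinder_def)
  \<comment> \<open>Exponents at distance at least 2 would give different starting vertices, but all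
    of these are 0.\<close>
  have close: "\<bar>K A - K B\<bar> \<le> 1" for A B
    using vershik_power_start_less[OF inc x, of "K A" "K B"]
      vershik_power_start_less[OF inc x, of "K B" "K A"] start[of A] start[of B] by fastforce
  have inj: "K A \<noteq> K B" if "A \<subseteq> {..<2}" "B \<subseteq> {..<2}" "A \<noteq> B" for A B
    using sign_cylinder_disjoint[of t 2 0 A 0 B, OF pos] K[of A] K[of B] that by (metis IntI empty_iff)
  show False
    \<comment> \<open>Three distinct integers cannot be pairwise at distance at most 1.\<close>
    using close[of "{}" "{0}"] close[of "{0}" "{1}"] close[of "{}" "{1}"]
      inj[of "{}" "{0}"] inj[of "{0}" "{1}"] inj[of "{}" "{1}"] by auto
qed

theorem corollary7p11:
  fixes t :: "nat \<Rightarrow> nat" and L :: "nat \<Rightarrow> int"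
  assumes "t 0 > 0"
    and "\<And>n. n \<ge> 1 \<Longrightarrow> t n > (\<Sum>k<n. t k)"
    and "L 0 = 2 * int (t 0)"
    and "\<And>n. n \<ge> 1 \<Longrightarrow> L n = 2 * (int (t n) - (\<Sum>k<n. int (t k)))"
  shows "((\<forall>s :: nat list. s \<noteq> [] \<longrightarrow> (\<Sum>i\<leftarrow>s. L i) \<noteq> 0) \<longrightarrow>
            \<not> (\<exists>M. tail_invariant t M \<and> prob_space M)) \<and>
         \<not> (\<exists>x\<in>path_space t.
              path_topology t closure_of vershik_orbit t x = path_space t)"
proof -
  \<comment> \<open>At \<open>n = 0\<close> the sum is empty, so this instance is the positivity of
    \<open>t 0\<close>.\<close>
  have inc: "(\<Sum>k<n. t k) < t n" for n
    using assms(1) assms(2)[of n] by (cases "n = 0") simp_all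
  show ?thesis
    using no_tail_invariant_prob[OF inc] no_dense_orbit[OF inc] by blast
qed

end
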